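(* Let $F=(F_1,F_2,F_3)$ be a triple of hermitian $3\times 3$ complex matrices such that the joint numerical range $W(F)\subset\mathbb{R}^3$ has no corner point. Let $\mathcal{L}(F)$ be the set of large faces of $W(F)$, let $e$ be the number of filled ellipses in $\mathcal{L}(F)$ and $s$ the number of segments in $\mathcal{L}(F)$. Then $\mathcal{L}(F)$ has one of the following eight configurations: $$(e,s)\in\{(0,0),(1,0),(2,0),(3,0),(4,0),(0,1),(1,1),(2,1)\},$$ where in each configuration any two distinct large faces intersect in exactly one point, and no point lies on three mutually distinct large faces.
   Context: For a triple $F=(F_1,F_2,F_3)$ of hermitian $3\times3$ complex matrices the joint numerical range is $$W(F)=\{(\langle x,F_1x\rangle,\langle x,F_2x\rangle,\langle x,F_3x\rangle)\mid x\in\mathbb{C}^3,\ \langle x,x\rangle=1\}\subset\mathbb{R}^3 ,$$ where $\langle x,y\rangle=\overline{x_1}y_1+\overline{x_2}y_2+\overline{x_3}y_3$; it is a compact convex set. An exposed face of $W(F)$ is a subset that is either empty or the set of maximizers over $W(F)$ of a linear functional on $\mathbb{R}^3$. A large face of $W(F)$ is an exposed face $G\neq W(F)$ of $W(F)$ that is a (non-degenerate) segment or a filled (non-degenerate) ellipse; $\mathcal{L}(F)$ is the set of large faces. A corner point of $W(F)$ is a point of $W(F)$ lying on three supporting hyperplanes of $W(F)$ with linearly independent normal vectors; equivalently, a point $x\in W(F)$ whose normal cone $\{u\in\mathbb{R}^3\mid \langle u,y-x\rangle\le 0\ \forall y\in W(F)\}$ has dimension $3$. *)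

theory Defs
  imports "HOL-Analysis.Analysis"
begin

definition cprod :: "complex^3 \<Rightarrow> complex^3 \<Rightarrow> complex" where
  "cprod x y = (\<Sum>i\<in>UNIV. cnj (x $ i) * y $ i)"

definition hermitian :: "complex^3^3 \<Rightarrow> bool" where
  "hermitian A \<longleftrightarrow> (\<forall>i j. A $ i $ j = cnj (A $ j $ i))"

(* A triple F is a vector of three matrices, with components F $ 1, F $ 2, F $ 3.
   For a hermitian matrix A the number cprod x (A *v x) is real (lemma
   cprod_hermitian_real below), so Re only changes the type. *)
definition joint_numerical_range :: "(complex^3^3)^3 \<Rightarrow> (real^3) set" where
  "joint_numerical_range F = {(\<chi> i. Re (cprod x (F $ i *v x))) | x. cprod x x = 1}"

lemma cprod_hermitian_real:
  assumes "hermitian A"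
  shows "of_real (Re (cprod x (A *v x))) = cprod x (A *v x)"
proof -
  have h: "cnj (A $ i $ j) = A $ j $ i" for i j
    using assms unfolding hermitian_def by (metis complex_cnj_cnj)
  have e: "cprod x (A *v x) = (\<Sum>i\<in>UNIV. \<Sum>j\<in>UNIV. cnj (x $ i) * (A $ i $ j * x $ j))"
    by (simp add: cprod_def matrix_vector_mult_def sum_distrib_left)
  have "cnj (cprod x (A *v x)) = (\<Sum>i\<in>UNIV. \<Sum>j\<in>UNIV. cnj (x $ j) * (A $ j $ i * x $ i))"
    unfolding e by (simp add: h mult_ac)
  also have "\<dots> = cprod x (A *v x)"
    unfolding e by (rule sum.swap)
  finally show ?thesis
    by (metis Reals_cnj_iff of_real_Re)
qed

definition normal_cone :: "(real^3) set \<Rightarrow> real^3 \<Rightarrow> (real^3) set" where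
  "normal_cone S x = {u. \<forall>y\<in>S. u \<bullet> (y - x) \<le> 0}"

(* A nonzero vector u of the normal cone at x \<in> S is an (outward) normal vector of the
   supporting hyperplane {y. u \<bullet> y = u \<bullet> x} of S through x. *)
definition corner_point :: "(real^3) set \<Rightarrow> real^3 \<Rightarrow> bool" where
  "corner_point S x \<longleftrightarrow>
     x \<in> S \<and> (\<exists>U \<subseteq> normal_cone S x. independent U \<and> card U = 3)"

definition nondegenerate_segment :: "(real^3) set \<Rightarrow> bool" where
  "nondegenerate_segment G \<longleftrightarrow> (\<exists>a b. a \<noteq> b \<and> G = closed_segment a b)"

(* c is the center; u and v are the semi-axes. *)
definition filled_ellipse :: "(real^3) set \<Rightarrow> bool" where
  "filled_ellipse G \<longleftrightarrow>
     (\<exists>c u v. u \<noteq> 0 \<and> v \<noteq> 0 \<and> u \<bullet> v = 0 \<and>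
        G = {c + s *\<^sub>R u + t *\<^sub>R v | s t. s\<^sup>2 + t\<^sup>2 \<le> 1})"

(* The library's exposed faces are the empty set and the sets of maximizers of linear
   functionals (the zero functional included). *)
lemma exposed_face_of_iff_maximizers:
  fixes S :: "(real^3) set"
  assumes "compact S" "convex S" "S \<noteq> {}"
  shows "T exposed_face_of S \<longleftrightarrow>
    T = {} \<or> (\<exists>u. T = {x \<in> S. \<forall>y\<in>S. u \<bullet> y \<le> u \<bullet> x})" (is "?L \<longleftrightarrow> ?R")
proof
  assume ?L
  then obtain a b where ab: "S \<subseteq> {x. a \<bullet> x \<le> b}" "T = S \<inter> {x. a \<bullet> x = b}"
    unfolding exposed_face_of_def by blast
  show ?R
  proof (cases "T = {}")
    case False
    then obtain z where "z \<in> S" "a \<bullet> z = b"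
      using ab by blast
    then have "T = {x \<in> S. \<forall>y\<in>S. a \<bullet> y \<le> a \<bullet> x}"
      using ab by (auto intro: antisym)
    then show ?thesis by blast
  qed simp
next
  assume ?R
  then show ?L
  proof
    assume "T = {}"
    then show ?L by simp
  next
    assume "\<exists>u. T = {x \<in> S. \<forall>y\<in>S. u \<bullet> y \<le> u \<bullet> x}"
    then obtain u where T: "T = {x \<in> S. \<forall>y\<in>S. u \<bullet> y \<le> u \<bullet> x}" by blast
    have "continuous_on S (\<lambda>x. u \<bullet> x)"
      by (intro continuous_intros)
    then obtain z where z: "z \<in> S" "\<And>y. y \<in> S \<Longrightarrow> u \<bullet> y \<le> u \<bullet> z"
      using continuous_attains_sup[OF assms(1) assms(3)] by blast
    have "T = S \<inter> {x. u \<bullet> x = u \<bullet> z}"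
      using T z by (auto intro: antisym)
    then show ?L
      using exposed_face_of_Int_supporting_hyperplane_le[OF assms(2)] z(2) by simp
  qed
qed

definition large_faces :: "(complex^3^3)^3 \<Rightarrow> (real^3) set set" where
  "large_faces F = {G. G exposed_face_of joint_numerical_range F \<and>
     G \<noteq> joint_numerical_range F \<and> (nondegenerate_segment G \<or> filled_ellipse G)}"

end

theory Submission
  imports Defs
begin

text \<open>The proof translates large faces into rank-one forms. Write w(x) for the vector of the
  values of F at x, and let the exposed face G of W = W(F) be cut out by a \<bullet> z \<le> b. The hermitian
  form b |x|^2 - a \<bullet> w(x) is positive semidefinite, and G is the image under w of the unit vectors
  in its kernel. A kernel of dimension 1 gives one point and a kernel of dimension 3 gives W, so
  for a large face the kernel has dimension 2 and the form equals |<v,x>|^2 for some v \<noteq> 0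
  (\<open>large_face_form\<close>). Distinct large faces have non-parallel v. Four facts follow.

  Two planes in three-dimensional complex space meet in a line, so two large faces meet in
  exactly one point (\<open>faces_meet_in_one_point\<close>).

  A relation between the normals of at most three large faces through one point p is also a
  relation between their offsets b = a \<bullet> p, hence between the forms |<v,x>|^2. Evaluating the
  polarised relation at a pair of vectors that together annihilate all v but one shows that each
  coefficient vanishes (\<open>rank_one_relation_coeff_zero\<close>). So three large faces with a common
  point have independent normals and make this point a corner.

  There are at most four large faces: the pairs (a,b) of five of them are dependent in a space of
  dimension four. Any two v have a common annihilator, and in the absence of corners it is
  annihilated by no third v. For each of the five, one such vector annihilates two of the others
  and another one the remaining two; the same evaluation makes every coefficient zero
  (\<open>no_five_large_faces\<close>).

  If two large faces are segments, they share an endpoint p. At an endpoint, the forms of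
  F - p have vanishing first variation along the kernel plane of the segment. The two planes span
  the space, so the vector over p is a common eigenvector of the three matrices, and p is a corner
  (\<open>two_segments_imp_corner\<close>). Hence there is at most one segment. As a face, any other large face
  meets it in one of its endpoints, and no endpoint lies on two others; so a segment leaves room
  for at most two ellipses.\<close>

section \<open>Sesquilinear algebra in three complex dimensions\<close>

lemma cprod_add_right: "cprod x (y + z) = cprod x y + cprod x z"
  by (simp add: cprod_def algebra_simps sum.distrib)

lemma cprod_add_left: "cprod (x + y) z = cprod x z + cprod y z"
  by (simp add: cprod_def algebra_simps sum.distrib)

lemma cprod_scale_right: "cprod x (c *s y) = c * cprod x y"
  by (simp add: cprod_def sum_distrib_left mult_ac)

lemma cprod_scale_left: "cprod (c *s x) y = cnj c * cprod x y"
  by (simp add: cprod_def sum_distrib_left mult_ac)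

lemma cprod_zero_right: "cprod x 0 = 0"
  by (simp add: cprod_def)

lemma cprod_zero_left: "cprod 0 x = 0"
  by (simp add: cprod_def)

lemmas cprod_linear = cprod_add_right cprod_add_left cprod_scale_right cprod_scale_left
  cprod_zero_right cprod_zero_left

lemma cprod_commute: "cprod y x = cnj (cprod x y)"
  by (simp add: cprod_def mult_ac)

lemma cprod_self: "cprod x x = complex_of_real (\<Sum>i\<in>UNIV. (cmod (x $ i))\<^sup>2)"
  by (simp add: cprod_def complex_norm_square mult_ac del: of_real_power)

lemma cprod_self_pos:
  assumes "x \<noteq> 0"
  shows "0 < Re (cprod x x)"
proof -
  obtain i where "x $ i \<noteq> 0"
    using assms by (auto simp: vec_eq_iff)
  then have "0 < (\<Sum>i\<in>UNIV. (cmod (x $ i))\<^sup>2)"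
    by (intro sum_pos2[of _ i]) auto
  then show ?thesis
    by (simp add: cprod_self)
qed

lemma cprod_self_of_real: "cprod x x = of_real (Re (cprod x x))"
  by (simp add: cprod_self)

lemma cprod_self_eq_0: "cprod x x = 0 \<longleftrightarrow> x = 0"
  using cprod_self_pos[of x] by (cases "x = 0") (auto simp: cprod_zero_right)

lemma normalize_cprod:
  assumes "x \<noteq> 0"
  obtains r y where "0 < r" "cprod y y = 1" "x = of_real r *s y"
proof -
  let ?r = "sqrt (Re (cprod x x))"
  have r: "0 < ?r"
    using cprod_self_pos[OF assms] by simp
  have "cprod (of_real (1 / ?r) *s x) (of_real (1 / ?r) *s x)
      = of_real (1 / ?r) * of_real (1 / ?r) * of_real (Re (cprod x x))"
    using cprod_self_of_real[of x] by (simp add: cprod_linear)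
  also have "\<dots> = of_real (1 / ?r * (1 / ?r) * Re (cprod x x))"
    by (simp only: of_real_mult)
  also have "1 / ?r * (1 / ?r) * Re (cprod x x) = 1"
    using cprod_self_pos[OF assms] by (simp add: field_simps)
  finally have u: "cprod (of_real (1 / ?r) *s x) (of_real (1 / ?r) *s x) = 1"
    by simp
  have "of_real ?r * of_real (1 / ?r) = (1 :: complex)"
    using r by (simp flip: of_real_mult)
  then have "x = of_real ?r *s (of_real (1 / ?r) *s x)"
    by (simp only: vector_smult_assoc vector_smult_lid)
  with r u show ?thesis
    by (rule that)
qed

lemma cprod_hermitian_move:
  assumes "hermitian A"
  shows "cprod (A *v x) y = cprod x (A *v y)"
proof -
  have h: "cnj (A $ i $ j) = A $ j $ i" for i j
    using assms unfolding hermitian_def by (metis complex_cnj_cnj)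
  have "cprod (A *v x) y = (\<Sum>i\<in>UNIV. \<Sum>j\<in>UNIV. cnj (x $ j) * (A $ j $ i * y $ i))"
    by (simp add: cprod_def matrix_vector_mult_def sum_distrib_right sum_distrib_left h mult_ac)
  also have "\<dots> = cprod x (A *v y)"
    by (subst sum.swap) (simp add: cprod_def matrix_vector_mult_def sum_distrib_left)
  finally show ?thesis .
qed

text \<open>The entries are conjugated because \<^const>\<open>cprod\<close> is conjugate linear in its first
  argument; this makes the product orthogonal to both factors.\<close>

definition ccross :: "complex^3 \<Rightarrow> complex^3 \<Rightarrow> complex^3" where
  "ccross x y = (\<chi> i. cnj (if i = 1 then x $ 2 * y $ 3 - x $ 3 * y $ 2
     else if i = 2 then x $ 3 * y $ 1 - x $ 1 * y $ 3
     else x $ 1 * y $ 2 - x $ 2 * y $ 1))"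

lemma ccross_components:
  "ccross x y $ 1 = cnj (x $ 2 * y $ 3 - x $ 3 * y $ 2)"
  "ccross x y $ 2 = cnj (x $ 3 * y $ 1 - x $ 1 * y $ 3)"
  "ccross x y $ 3 = cnj (x $ 1 * y $ 2 - x $ 2 * y $ 1)"
  by (simp_all add: ccross_def)

lemma cprod_3: "cprod x y = cnj (x $ 1) * y $ 1 + cnj (x $ 2) * y $ 2 + cnj (x $ 3) * y $ 3"
  by (simp add: cprod_def sum_3)

lemma cprod_ccross: "cprod x (ccross x y) = 0" "cprod y (ccross x y) = 0"
  by (simp_all add: cprod_3 ccross_components algebra_simps)

lemma ccross_zero_imp_scale:
  assumes "x \<noteq> 0" "ccross x y = 0"
  obtains k where "y = k *s x"
proof -
  have e: "x $ 2 * y $ 3 = x $ 3 * y $ 2" "x $ 3 * y $ 1 = x $ 1 * y $ 3"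
    "x $ 1 * y $ 2 = x $ 2 * y $ 1"
    using ccross_components[of x y, folded complex_cnj_zero_iff] unfolding assms(2)
    by (simp_all only: zero_index complex_cnj_zero_iff eq_commute[of 0] right_minus_eq)
  obtain i where i: "x $ i \<noteq> 0"
    using assms(1) by (auto simp: vec_eq_iff)
  have "x $ i * y $ j = x $ j * y $ i" for j
    using exhaust_3[of i] exhaust_3[of j] e by auto
  then have "y = (y $ i / x $ i) *s x"
    using i by (simp add: vec_eq_iff field_simps)
  then show ?thesis
    by (rule that)
qed

lemma ccross_spans_annihilator:
  assumes "ccross x y \<noteq> 0" "cprod x z = 0" "cprod y z = 0"
  obtains k where "z = k *s ccross x y"
proof -
  let ?c = "ccross x y"
  have 1: "cnj (x $ 1) * z $ 1 + cnj (x $ 2) * z $ 2 + cnj (x $ 3) * z $ 3 = 0"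
    and 2: "cnj (y $ 1) * z $ 1 + cnj (y $ 2) * z $ 2 + cnj (y $ 3) * z $ 3 = 0"
    using assms(2,3) by (simp_all add: cprod_3)
  have 12: "?c $ 1 * z $ 2 = ?c $ 2 * z $ 1"
    unfolding ccross_components complex_cnj_diff complex_cnj_mult using 1 2 by algebra
  have 13: "?c $ 1 * z $ 3 = ?c $ 3 * z $ 1"
    unfolding ccross_components complex_cnj_diff complex_cnj_mult using 1 2 by algebra
  have 23: "?c $ 2 * z $ 3 = ?c $ 3 * z $ 2"
    unfolding ccross_components complex_cnj_diff complex_cnj_mult using 1 2 by algebra
  have "ccross ?c z = 0"
    by (simp add: vec_eq_iff forall_3 ccross_components[of ?c z] 12 13 23)
  then show ?thesis
    using ccross_zero_imp_scale[OF assms(1)] that by blast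
qed

lemma separate_functionals:
  assumes "ccross v w \<noteq> 0"
  obtains x where "cprod v x = 0" "cprod w x = 1"
proof -
  let ?x = "ccross v (ccross v w)"
  have v: "v \<noteq> 0"
    using assms by (auto simp: vec_eq_iff forall_3 ccross_components)
  have nz: "?x \<noteq> 0"
  proof
    assume "?x = 0"
    then obtain k where k: "ccross v w = k *s v"
      using ccross_zero_imp_scale[OF v] by blast
    have "k * cprod v v = 0"
      using cprod_ccross(1)[of v w] unfolding k by (simp add: cprod_linear)
    then show False
      using assms v k by (auto simp: cprod_self_eq_0)
  qed
  have "cprod w ?x \<noteq> 0"
  proof
    assume "cprod w ?x = 0"
    then obtain k where k: "?x = k *s ccross v w"
      using ccross_spans_annihilator[OF assms cprod_ccross(1)] by blast
    have "cprod ?x ?x = cnj k * cprod (ccross v w) ?x"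
      by (subst k) (simp add: cprod_linear)
    then show False
      using nz cprod_ccross(2)[of "ccross v w" v] by (simp add: cprod_ccross cprod_self_eq_0)
  qed
  then show ?thesis
    using that[of "(1 / cprod w ?x) *s ?x"] by (simp add: cprod_linear cprod_ccross)
qed

section \<open>Hermitian forms\<close>

text \<open>Near 0 the linear term dominates and takes both signs. The point \<open>t = - A / (1 + \<bar>B\<bar>)\<close> is
  close enough to 0 to show this.\<close>

lemma quadratic_nonneg_imp_linear_zero:
  fixes A B :: real
  assumes "\<And>t. 0 \<le> 2 * t * A + t\<^sup>2 * B"
  shows "A = 0"
proof (rule ccontr)
  assume A: "A \<noteq> 0"
  define D where "D = 1 + \<bar>B\<bar>"
  have D: "0 < D" "B < D" "B \<le> 2 * D"
    by (auto simp: D_def)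
  have "0 \<le> 2 * (- A / D) * A + (- A / D)\<^sup>2 * B"
    by (rule assms)
  also have "\<dots> = A\<^sup>2 * (B - 2 * D) / D\<^sup>2"
    using D(1) by (simp add: field_simps power2_eq_square)
  also have "\<dots> < 0"
    using A D by (intro divide_neg_pos mult_pos_neg) auto
  finally show False by simp
qed

lemma hermitian_form_add:
  assumes "hermitian M"
  shows "Re (cprod (x + y) (M *v (x + y)))
    = Re (cprod x (M *v x)) + 2 * Re (cprod x (M *v y)) + Re (cprod y (M *v y))"
proof -
  have "cprod y (M *v x) = cnj (cprod x (M *v y))"
    using cprod_commute[of "M *v y" x] cprod_hermitian_move[OF assms, of y x]
    by (metis cprod_commute)
  then show ?thesis
    by (simp add: matrix_vector_right_distrib cprod_linear)
qed

lemma matrix_vector_scale: "M *v (c *s y) = c *s (M *v (y :: complex^3))" for M :: "complex^3^3"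
  by (simp add: vec_eq_iff matrix_vector_mult_def sum_distrib_left mult_ac)

text \<open>The form vanishes at x and is nonnegative on the complex line through x in direction y, so
  its first variation vanishes. Nonnegativity is asked on this line only, because the forms attached to
  the endpoint of a segment have a sign only on the kernel plane of that segment.\<close>

lemma nonneg_form_zero_imp_orthogonal:
  assumes "hermitian M" "Re (cprod x (M *v x)) = 0"
    and nonneg: "\<And>c. 0 \<le> Re (cprod (x + c *s y) (M *v (x + c *s y)))"
  shows "cprod x (M *v y) = 0"
proof -
  define z where "z = cprod x (M *v y)"
  have "0 \<le> 2 * t * (cmod z)\<^sup>2 + t\<^sup>2 * ((cmod z)\<^sup>2 * Re (cprod y (M *v y)))" for t :: real
  proof -
    \<comment> \<open>This phase makes the mixed term equal to \<open>t * (cmod z)\<^sup>2\<close>, which is real.\<close>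
    define c where "c = of_real t * cnj z"
    have "cprod x (M *v (c *s y)) = of_real (t * (cmod z)\<^sup>2)"
      by (simp add: c_def matrix_vector_scale cprod_linear complex_norm_square mult_ac
        del: of_real_power flip: z_def)
    then have 1: "Re (cprod x (M *v (c *s y))) = t * (cmod z)\<^sup>2"
      by simp
    have "cprod (c *s y) (M *v (c *s y)) = of_real ((cmod c)\<^sup>2) * cprod y (M *v y)"
      by (simp add: matrix_vector_scale cprod_linear complex_norm_square mult_ac del: of_real_power)
    then have 2: "Re (cprod (c *s y) (M *v (c *s y))) = t\<^sup>2 * ((cmod z)\<^sup>2 * Re (cprod y (M *v y)))"
      by (simp add: c_def norm_mult power_mult_distrib del: of_real_power)
    show ?thesis
      using nonneg[of c] unfolding hermitian_form_add[OF assms(1)] 1 2 assms(2) by simp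
  qed
  then have "(cmod z)\<^sup>2 = 0"
    by (rule quadratic_nonneg_imp_linear_zero)
  then show ?thesis
    by (simp add: z_def)
qed

lemma hermitian_mult_zero:
  assumes "hermitian M" "\<And>y. cprod x (M *v y) = 0"
  shows "M *v x = 0"
  using assms(2)[of "M *v x"] cprod_hermitian_move[OF assms(1), of x "M *v x"]
  by (simp add: cprod_self_eq_0)

text \<open>The range of M is orthogonal to its kernel, hence lies on the line spanned by the cross
  product of y and z; a hermitian matrix of rank one is a real multiple of a projection.\<close>

lemma hermitian_two_dim_kernel_form:
  assumes "hermitian M" "M *v y = 0" "M *v z = 0" "ccross y z \<noteq> 0"
  obtains s :: real where "\<And>x. Re (cprod x (M *v x)) = s * (cmod (cprod (ccross y z) x))\<^sup>2"
proof -
  define c where "c = ccross y z"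
  have "\<exists>k. M *v x = k *s c" for x
    using ccross_spans_annihilator[OF assms(4)] cprod_hermitian_move[OF assms(1), of _ x]
      assms(2,3) cprod_zero_left unfolding c_def by metis
  then obtain k where k: "\<And>x. M *v x = k x *s c"
    by metis
  have cc: "cprod c c \<noteq> 0"
    using assms(4) by (simp add: c_def cprod_self_eq_0)
  have "k x * cprod c c = cnj (k c) * cprod c x" for x
    using cprod_hermitian_move[OF assms(1), of c x] by (simp add: k cprod_linear)
  then have kx: "k x = cnj (k c) / cprod c c * cprod c x" for x
    using cc by (simp add: field_simps)
  define m where "m = cnj (k c) / cprod c c"
  have "cprod x (M *v x) = m * of_real ((cmod (cprod c x))\<^sup>2)" for x
    using cprod_commute[of x c] kx[of x, folded m_def]
    by (simp add: k cprod_linear complex_norm_square mult_ac del: of_real_power)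
  then have "Re (cprod x (M *v x)) = Re m * (cmod (cprod c x))\<^sup>2" for x
    by (simp del: of_real_power)
  then show ?thesis
    using that unfolding c_def by blast
qed

text \<open>Polarisation turns the relation between the squares into
  \<open>(\<Sum>i\<in>T. \<alpha> i * cnj (cprod (v i) x) * cprod (v i) y) = 0\<close> for all x and y. Vectors x and y that
  together annihilate every v except \<open>v j\<close> isolate the coefficient of j. The lemma is applied to
  two or three faces through one point and to five arbitrary faces.\<close>

lemma rank_one_relation_coeff_zero:
  fixes \<alpha> :: "'i \<Rightarrow> real" and v :: "'i \<Rightarrow> complex^3"
  assumes rel: "\<And>x. (\<Sum>i\<in>T. \<alpha> i * (cmod (cprod (v i) x))\<^sup>2) = 0"
    and "finite T" "j \<in> T"
    and kill: "\<And>i. i \<in> T \<Longrightarrow> i \<noteq> j \<Longrightarrow> cprod (v i) x = 0 \<or> cprod (v i) y = 0"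
    and nz: "cprod (v j) x \<noteq> 0" "cprod (v j) y \<noteq> 0"
  shows "\<alpha> j = 0"
proof -
  define P where "P y = (\<Sum>i\<in>T. of_real (\<alpha> i) * (cnj (cprod (v i) x) * cprod (v i) y))" for y
  have "2 * Re (P y) = (\<Sum>i\<in>T. \<alpha> i * (cmod (cprod (v i) (x + y)))\<^sup>2)
      - (\<Sum>i\<in>T. \<alpha> i * (cmod (cprod (v i) x))\<^sup>2) - (\<Sum>i\<in>T. \<alpha> i * (cmod (cprod (v i) y))\<^sup>2)" for y
    unfolding P_def Re_sum sum_distrib_left sum_subtractf[symmetric]
    by (intro sum.cong refl)
      (simp only: cprod_linear cmod_power2, simp add: power2_eq_square algebra_simps)
  then have ReP: "Re (P y) = 0" for y
    by (simp add: rel)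
  \<comment> \<open>Replacing y by its multiple by the imaginary unit turns the real part into the imaginary part.\<close>
  have "P (\<i> *s y) = \<i> * P y"
    unfolding P_def sum_distrib_left by (intro sum.cong refl) (simp add: cprod_linear)
  then have "P y = 0"
    using ReP[of y] ReP[of "\<i> *s y"] by (simp add: complex_eq_iff)
  moreover have "P y = of_real (\<alpha> j) * (cnj (cprod (v j) x) * cprod (v j) y)
      + (\<Sum>i\<in>T - {j}. of_real (\<alpha> i) * (cnj (cprod (v i) x) * cprod (v i) y))"
    unfolding P_def using assms(2,3) by (rule sum.remove)
  moreover have "(\<Sum>i\<in>T - {j}. of_real (\<alpha> i) * (cnj (cprod (v i) x) * cprod (v i) y)) = 0"
    using kill by (intro sum.neutral) auto
  ultimately show ?thesis
    using nz by simp
qed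

section \<open>The pencil and the forms of large faces\<close>

definition expectation :: "(complex^3^3)^3 \<Rightarrow> complex^3 \<Rightarrow> real^3" where
  "expectation F x = (\<chi> i. Re (cprod x (F $ i *v x)))"

lemma joint_numerical_range_expectation:
  "joint_numerical_range F = {expectation F x | x. cprod x x = 1}"
  by (simp add: joint_numerical_range_def expectation_def)

lemma expectation_scale: "expectation F (c *s x) = (cmod c)\<^sup>2 *\<^sub>R expectation F x"
proof -
  have "cprod (c *s x) (F $ i *v (c *s x)) = of_real ((cmod c)\<^sup>2) * cprod x (F $ i *v x)" for i
    by (simp add: matrix_vector_scale cprod_linear complex_norm_square mult_ac del: of_real_power)
  then show ?thesis
    by (simp add: expectation_def vec_eq_iff del: of_real_power)
qed

lemma expectation_scale_unit:
  assumes "cprod x x = 1" "cprod y y = 1" "y = k *s x"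
  shows "expectation F y = expectation F x"
proof -
  have "of_real ((cmod k)\<^sup>2) = (1 :: complex)"
    using assms(1,2) unfolding assms(3)
    by (simp add: cprod_linear complex_norm_square mult_ac del: of_real_power)
  then have "(cmod k)\<^sup>2 = 1"
    using of_real_eq_1_iff by blast
  then show ?thesis
    by (simp add: assms(3) expectation_scale)
qed

definition pencil :: "(complex^3^3)^3 \<Rightarrow> real^3 \<Rightarrow> real \<Rightarrow> complex^3^3" where
  "pencil F a b = b *\<^sub>R mat 1 - (\<Sum>k\<in>UNIV. a $ k *\<^sub>R F $ k)"

lemma hermitian_pencil:
  assumes "\<forall>i. hermitian (F $ i)"
  shows "hermitian (pencil F a b)"
proof -
  have "cnj (F $ k $ j $ i) = F $ k $ i $ j" for i j k
    using assms unfolding hermitian_def by metis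
  then show ?thesis
    by (simp add: hermitian_def pencil_def mat_def)
qed

lemma pencil_uminus: "pencil F (- a) (- b) *v x = - (pencil F a b *v x)"
  by (simp add: vec_eq_iff pencil_def matrix_vector_mult_def sum_3 algebra_simps)

lemma pencil_form:
  "Re (cprod x (pencil F a b *v x)) = b * Re (cprod x x) - a \<bullet> expectation F x"
proof -
  have "pencil F a b *v x = of_real b *s x - (\<Sum>k\<in>UNIV. of_real (a $ k) *s (F $ k *v x))"
    unfolding pencil_def sum_3
    by (simp add: vec_eq_iff matrix_vector_mult_def sum_3 forall_3 mat_def
      scaleR_conv_of_real[where 'a = complex] algebra_simps)
  moreover have "cprod x (y - z) = cprod x y - cprod x z" for y z
    using cprod_add_right[of x "y - z" z] by simp
  ultimately have "cprod x (pencil F a b *v x)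
      = of_real b * cprod x x - (\<Sum>k\<in>UNIV. of_real (a $ k) * cprod x (F $ k *v x))"
    by (simp add: sum_3 cprod_linear)
  then show ?thesis
    by (simp add: inner_vec_def expectation_def)
qed

text \<open>The inequality \<open>a \<bullet> z \<le> b\<close> is valid on the joint numerical range, as its defect is
  \<open>(cmod (cprod v x))\<^sup>2\<close>, and it cuts out the face G.\<close>

definition face_form ::
  "(complex^3^3)^3 \<Rightarrow> (real^3) set \<Rightarrow> real^3 \<Rightarrow> real \<Rightarrow> complex^3 \<Rightarrow> bool" where
  "face_form F G a b v \<longleftrightarrow> v \<noteq> 0 \<and>
     (\<forall>x. b * Re (cprod x x) - a \<bullet> expectation F x = (cmod (cprod v x))\<^sup>2) \<and>
     G = {expectation F x | x. cprod x x = 1 \<and> cprod v x = 0}"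

lemma face_formD:
  assumes "face_form F G a b v"
  shows "v \<noteq> 0" "b * Re (cprod x x) - a \<bullet> expectation F x = (cmod (cprod v x))\<^sup>2"
    "G = {expectation F x | x. cprod x x = 1 \<and> cprod v x = 0}"
  using assms unfolding face_form_def by blast+

lemma filled_ellipse_not_segment:
  assumes "filled_ellipse G"
  shows "\<not> nondegenerate_segment G"
proof
  assume "nondegenerate_segment G"
  then obtain p q where G: "G = closed_segment p q"
    unfolding nondegenerate_segment_def by blast
  obtain c u v where u: "u \<noteq> 0" "v \<noteq> 0" "u \<bullet> v = 0"
    and E: "G = {c + s *\<^sub>R u + t *\<^sub>R v | s t. s\<^sup>2 + t\<^sup>2 \<le> 1}"
    using assms unfolding filled_ellipse_def by blast
  have "c \<in> G"
    unfolding E by (rule CollectI, rule exI[of _ 0], rule exI[of _ 0]) simp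
  moreover have "c + u \<in> G"
    unfolding E by (rule CollectI, rule exI[of _ 1], rule exI[of _ 0]) simp
  moreover have "c + v \<in> G"
    unfolding E by (rule CollectI, rule exI[of _ 0], rule exI[of _ 1]) simp
  ultimately obtain r s t where "c = p + r *\<^sub>R (q - p)" "c + u = p + s *\<^sub>R (q - p)"
    "c + v = p + t *\<^sub>R (q - p)"
    unfolding G closed_segment_def by (auto simp: algebra_simps)
  then have uv: "u = (s - r) *\<^sub>R (q - p)" "v = (t - r) *\<^sub>R (q - p)"
    unfolding scaleR_left_diff_distrib by (metis add_diff_cancel_left add_diff_cancel_left')+
  then show False
    using u by auto
qed

lemma large_face_two_points:
  assumes "G \<in> large_faces F"
  obtains p q where "p \<in> G" "q \<in> G" "p \<noteq> q"
proof -
  consider "nondegenerate_segment G" | "filled_ellipse G"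
    using assms unfolding large_faces_def by blast
  then show ?thesis
  proof cases
    case 1
    then show ?thesis
      using that unfolding nondegenerate_segment_def by auto
  next
    case 2
    then obtain c u v where u: "u \<noteq> 0"
      and E: "G = {c + s *\<^sub>R u + t *\<^sub>R v | s t. s\<^sup>2 + t\<^sup>2 \<le> 1}"
      unfolding filled_ellipse_def by blast
    have "c \<in> G"
      unfolding E by (rule CollectI, rule exI[of _ 0], rule exI[of _ 0]) simp
    moreover have "c + u \<in> G"
      unfolding E by (rule CollectI, rule exI[of _ 1], rule exI[of _ 0]) simp
    ultimately show ?thesis
      using u that by (metis add_cancel_left_right)
  qed
qed

text \<open>Two distinct points of G come from two independent kernel vectors of the positive
  semidefinite matrix \<open>b - (\<Sum>k. a $ k * F $ k)\<close>; if the matrix were zero, G would be the whole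
  joint numerical range. So it has rank one, and its positive factor is absorbed into v.\<close>

lemma large_face_form:
  assumes F: "\<forall>i. hermitian (F $ i)" and G: "G \<in> large_faces F"
  obtains a b v where "face_form F G a b v"
proof -
  let ?W = "joint_numerical_range F"
  obtain a b where sub: "?W \<subseteq> {x. a \<bullet> x \<le> b}" and GW: "G = ?W \<inter> {x. a \<bullet> x = b}"
    and neq: "G \<noteq> ?W"
    using G unfolding large_faces_def exposed_face_of_def by blast
  define M where "M = pencil F a b"
  have M: "hermitian M"
    unfolding M_def by (rule hermitian_pencil[OF F])
  note form = pencil_form[of _ F a b, folded M_def]
  have nonneg: "0 \<le> Re (cprod x (M *v x))" for x
  proof (cases "x = 0")
    case False
    then obtain r y where y: "cprod y y = 1" "x = of_real r *s y"
      using normalize_cprod by blast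
    have "expectation F y \<in> ?W"
      using y(1) by (auto simp: joint_numerical_range_expectation)
    then have "0 \<le> Re (cprod y (M *v y))"
      using sub y(1) by (auto simp: form)
    moreover have "Re (cprod x (M *v x)) = r\<^sup>2 * Re (cprod y (M *v y))"
      by (simp add: y matrix_vector_scale cprod_linear power2_eq_square)
    ultimately show ?thesis by simp
  qed (simp add: cprod_zero_left)
  have ker: "M *v x = 0" if "Re (cprod x (M *v x)) = 0" for x
    using hermitian_mult_zero[OF M] nonneg_form_zero_imp_orthogonal[OF M that nonneg] by blast
  obtain p q where pq: "p \<in> G" "q \<in> G" "p \<noteq> q"
    using large_face_two_points[OF G] .
  obtain y z where y: "cprod y y = 1" "p = expectation F y" and z: "cprod z z = 1" "q = expectation F z"
    using pq(1,2) by (auto simp: GW joint_numerical_range_expectation)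
  have My: "M *v y = 0" and Mz: "M *v z = 0"
    using pq y z by (auto intro!: ker simp: form GW)
  have yz: "ccross y z \<noteq> 0"
  proof
    assume 0: "ccross y z = 0"
    have "y \<noteq> 0"
      using y(1) by (auto simp: cprod_zero_left)
    then obtain k where "z = k *s y"
      using ccross_zero_imp_scale 0 by blast
    then show False
      using expectation_scale_unit[OF y(1) z(1)] pq(3) y(2) z(2) by metis
  qed
  obtain s where s: "\<And>x. Re (cprod x (M *v x)) = s * (cmod (cprod (ccross y z) x))\<^sup>2"
    using hermitian_two_dim_kernel_form[OF M My Mz yz] by blast
  obtain x where x: "cprod x x = 1" "expectation F x \<notin> G"
    using neq by (auto simp: GW joint_numerical_range_expectation)
  then have "Re (cprod x (M *v x)) \<noteq> 0"
    by (auto simp: GW joint_numerical_range_expectation form)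
  with nonneg[of x] have "0 < Re (cprod x (M *v x))"
    by linarith
  then have "0 < s * (cmod (cprod (ccross y z) x))\<^sup>2"
    by (simp only: s)
  then have spos: "0 < s"
    by (simp add: zero_less_mult_iff)
  define v where "v = of_real (sqrt s) *s ccross y z"
  have q: "b * Re (cprod x x) - a \<bullet> expectation F x = (cmod (cprod v x))\<^sup>2" for x
    using s[of x] spos
    by (simp add: form[symmetric] v_def cprod_linear norm_mult power_mult_distrib)
  have "face_form F G a b v"
    unfolding face_form_def
  proof (intro conjI allI)
    show "v \<noteq> 0"
      using yz spos by (simp add: v_def)
    have "a \<bullet> expectation F x = b \<longleftrightarrow> cprod v x = 0" if "cprod x x = 1" for x
      using q[of x] that by auto
    then show "G = {expectation F x | x. cprod x x = 1 \<and> cprod v x = 0}"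
      by (auto simp: GW joint_numerical_range_expectation)
  qed (rule q)
  then show ?thesis by (rule that)
qed

lemma large_face_forms:
  assumes "\<forall>i. hermitian (F $ i)"
  obtains a b v where "\<And>G. G \<in> large_faces F \<Longrightarrow> face_form F G (a G) (b G) (v G)"
proof -
  have "\<forall>G\<in>large_faces F. \<exists>a b v. face_form F G a b v"
    using large_face_form[OF assms] by meson
  then obtain a b v where "\<forall>G\<in>large_faces F. face_form F G (a G) (b G) (v G)"
    by metis
  then show ?thesis
    using that by blast
qed

lemma face_form_scaled_point:
  assumes "face_form F G a b v" "x \<noteq> 0" "cprod v x = 0"
  obtains g where "g \<in> G" "expectation F x = Re (cprod x x) *\<^sub>R g"
proof -
  obtain r y where r: "0 < r" "cprod y y = 1" "x = of_real r *s y"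
    using normalize_cprod[OF assms(2)] by blast
  have "cprod v y = 0"
    using assms(3) r by (simp add: cprod_linear)
  then have "expectation F y \<in> G"
    unfolding face_formD(3)[OF assms(1)] using r(2) by blast
  moreover have "expectation F x = Re (cprod x x) *\<^sub>R expectation F y"
    using r by (simp add: expectation_scale cprod_linear power2_eq_square)
  ultimately show ?thesis
    by (rule that)
qed

lemma common_kernel_imp_common_point:
  assumes "x \<noteq> 0"
  obtains p where "\<And>G a b v. face_form F G a b v \<Longrightarrow> cprod v x = 0 \<Longrightarrow> p \<in> G"
proof -
  obtain r y where r: "0 < r" "cprod y y = 1" "x = of_real r *s y"
    using normalize_cprod[OF assms] by blast
  have "expectation F y \<in> G" if "face_form F G a b v" "cprod v x = 0" for G a b v
    using that(2) r face_formD(3)[OF that(1)] by (auto simp: cprod_linear)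
  then show ?thesis
    using that by blast
qed

lemma point_of_face_kernel:
  assumes "face_form F G a b v" "cprod x x = 1" "expectation F x \<in> G"
  shows "cprod v x = 0"
proof -
  obtain y where y: "expectation F x = expectation F y" "cprod y y = 1" "cprod v y = 0"
    using assms(3) unfolding face_formD(3)[OF assms(1)] by blast
  then show ?thesis
    using face_formD(2)[OF assms(1), of x] face_formD(2)[OF assms(1), of y] assms(2) by simp
qed

lemma distinct_faces_ccross:
  assumes G: "face_form F G a b v" and H: "face_form F H a' b' v'" and "G \<noteq> H"
  shows "ccross v v' \<noteq> 0"
proof
  assume "ccross v v' = 0"
  then obtain k where k: "v' = k *s v"
    using ccross_zero_imp_scale face_formD(1)[OF G] by blast
  then have "k \<noteq> 0"
    using face_formD(1)[OF H] by auto
  then have "G = H"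
    unfolding face_formD(3)[OF G] face_formD(3)[OF H] k by (simp add: cprod_linear)
  with assms(3) show False ..
qed

text \<open>The kernel planes of two non-parallel functionals meet in a line, and its unit vectors differ
  by phases only, which do not change the point.\<close>

lemma faces_meet_in_one_point:
  assumes G: "face_form F G a b v" and H: "face_form F H a' b' v'" and "G \<noteq> H"
  shows "\<exists>!p. p \<in> G \<inter> H"
proof -
  have c: "ccross v v' \<noteq> 0"
    using distinct_faces_ccross[OF assms] .
  show ?thesis
  proof (rule ex_ex1I)
    show "\<exists>p. p \<in> G \<inter> H"
      using common_kernel_imp_common_point[OF c] G H cprod_ccross by (metis IntI)
  next
    fix p q assume "p \<in> G \<inter> H" "q \<in> G \<inter> H"
    then obtain x y where x: "cprod x x = 1" "p = expectation F x" and "cprod v x = 0"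
      and y: "cprod y y = 1" "q = expectation F y" and "cprod v y = 0"
      unfolding face_formD(3)[OF G] by blast
    moreover have "cprod v' x = 0" "cprod v' y = 0"
      using point_of_face_kernel[OF H] x y \<open>p \<in> G \<inter> H\<close> \<open>q \<in> G \<inter> H\<close> by auto
    ultimately obtain k l where k: "x = k *s ccross v v'" "y = l *s ccross v v'"
      using ccross_spans_annihilator[OF c] by metis
    then have "k \<noteq> 0"
      using x(1) by (auto simp: cprod_zero_left)
    then have "y = (l / k) *s x"
      by (simp add: k)
    then show "p = q"
      using expectation_scale_unit[OF x(1) y(1)] x(2) y(2) by metis
  qed
qed

section \<open>Corner points\<close>

lemma independent_three:
  fixes a b c :: "real^3"
  assumes "\<And>\<alpha> \<beta> \<gamma>. \<alpha> *\<^sub>R a + \<beta> *\<^sub>R b + \<gamma> *\<^sub>R c = 0 \<Longrightarrow> \<alpha> = 0 \<and> \<beta> = 0 \<and> \<gamma> = 0"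
  shows "independent {a, b, c}" "card {a, b, c} = 3"
proof -
  have d: "a \<noteq> b" "a \<noteq> c" "b \<noteq> c"
    using assms[of 1 "-1" 0] assms[of 1 0 "-1"] assms[of 0 1 "-1"] by auto
  then show "card {a, b, c} = 3"
    by simp
  show "independent {a, b, c}"
  proof
    assume "dependent {a, b, c}"
    then obtain u where u: "\<exists>x\<in>{a, b, c}. u x \<noteq> 0" "(\<Sum>x\<in>{a, b, c}. u x *\<^sub>R x) = 0"
      using dependent_finite[of "{a, b, c}"] by auto
    then have "u a *\<^sub>R a + u b *\<^sub>R b + u c *\<^sub>R c = 0"
      using d by (simp add: add.assoc)
    then show False
      using assms u(1) by blast
  qed
qed

lemma corner_pointI:
  assumes "p \<in> S" "a \<in> normal_cone S p" "b \<in> normal_cone S p" "c \<in> normal_cone S p"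
    and "\<And>\<alpha> \<beta> \<gamma>. \<alpha> *\<^sub>R a + \<beta> *\<^sub>R b + \<gamma> *\<^sub>R c = 0 \<Longrightarrow> \<alpha> = 0 \<and> \<beta> = 0 \<and> \<gamma> = 0"
  shows "corner_point S p"
  unfolding corner_point_def
  using assms(1-4) independent_three[OF assms(5)] by (intro conjI exI[of _ "{a, b, c}"]) auto

lemma face_form_in_range:
  assumes "face_form F G a b v" "p \<in> G"
  shows "p \<in> joint_numerical_range F"
  using assms(2) unfolding face_formD(3)[OF assms(1)] joint_numerical_range_expectation by blast

lemma face_form_offset:
  assumes "face_form F G a b v" "p \<in> G"
  shows "b = a \<bullet> p"
proof -
  obtain x where "p = expectation F x" "cprod x x = 1" "cprod v x = 0"
    using assms(2) unfolding face_formD(3)[OF assms(1)] by blast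
  then show ?thesis
    using face_formD(2)[OF assms(1), of x] by simp
qed

lemma face_form_gap:
  assumes "face_form F G a b v" "p \<in> G" "cprod x x = 1"
  shows "a \<bullet> (expectation F x - p) = - (cmod (cprod v x))\<^sup>2"
  using face_formD(2)[OF assms(1), of x] assms(3)
  by (simp add: face_form_offset[OF assms(1,2)] inner_diff_right)

lemma face_form_normal:
  assumes "face_form F G a b v" "p \<in> G"
  shows "a \<in> normal_cone (joint_numerical_range F) p"
  by (auto simp: normal_cone_def joint_numerical_range_expectation face_form_gap[OF assms])

lemma face_normals_relation:
  assumes "finite T" and ff: "\<And>i. i \<in> T \<Longrightarrow> face_form F (G i) (a i) (b i) (v i)"
    and "(\<Sum>i\<in>T. \<alpha> i *\<^sub>R a i) = 0" "(\<Sum>i\<in>T. \<alpha> i * b i) = 0"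
  shows "(\<Sum>i\<in>T. \<alpha> i * (cmod (cprod (v i) x))\<^sup>2) = 0"
proof -
  have "(\<Sum>i\<in>T. \<alpha> i * (cmod (cprod (v i) x))\<^sup>2)
      = (\<Sum>i\<in>T. \<alpha> i * b i * Re (cprod x x) - (\<alpha> i *\<^sub>R a i) \<bullet> expectation F x)"
    by (intro sum.cong refl) (simp add: face_formD(2)[OF ff, symmetric] algebra_simps)
  also have "\<dots> = (\<Sum>i\<in>T. \<alpha> i * b i) * Re (cprod x x) - (\<Sum>i\<in>T. \<alpha> i *\<^sub>R a i) \<bullet> expectation F x"
    by (simp add: sum_subtractf sum_distrib_right inner_sum_left)
  finally show ?thesis
    by (simp add: assms(3,4))
qed

text \<open>At the common point p all offsets are \<open>b i = a i \<bullet> p\<close>, so a relation between the normals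
  extends to the offsets and gives a relation between the rank-one forms. For each j at most two
  other faces remain, and x and y need to annihilate one each.\<close>

lemma face_normals_through_point_coeff_zero:
  assumes ff: "\<And>i. i \<in> T \<Longrightarrow> face_form F (G i) (a i) (b i) (v i)"
    and p: "\<And>i. i \<in> T \<Longrightarrow> p \<in> G i" and T: "finite T" "inj_on G T" "card T \<le> 3"
    and rel: "(\<Sum>i\<in>T. \<alpha> i *\<^sub>R a i) = 0" and j: "j \<in> T"
  shows "\<alpha> j = 0"
proof -
  have "(\<Sum>i\<in>T. \<alpha> i * b i) = (\<Sum>i\<in>T. \<alpha> i *\<^sub>R a i) \<bullet> p"
    by (simp add: inner_sum_left face_form_offset[OF ff p])
  then have sq: "(\<Sum>i\<in>T. \<alpha> i * (cmod (cprod (v i) x))\<^sup>2) = 0" for x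
    using rel by (intro face_normals_relation[OF T(1) ff]) auto
  have ex: "\<exists>x. cprod (v i) x = 0 \<and> cprod (v j) x \<noteq> 0" if "i \<in> T - {j}" for i
  proof -
    have "ccross (v i) (v j) \<noteq> 0"
      using that j T(2) by (intro distinct_faces_ccross[OF ff ff]) (auto dest: inj_onD)
    then show ?thesis
      using separate_functionals by (metis zero_neq_one)
  qed
  have "card (T - {j}) \<le> 2"
    using T(1,3) j by simp
  then obtain x y where "cprod (v j) x \<noteq> 0" "cprod (v j) y \<noteq> 0"
    "\<And>i. i \<in> T - {j} \<Longrightarrow> cprod (v i) x = 0 \<or> cprod (v i) y = 0"
  proof -
    have nz: "cprod (v j) (v j) \<noteq> 0"
      using face_formD(1)[OF ff[OF j]] by (simp add: cprod_self_eq_0)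
    consider "card (T - {j}) = 0" | "card (T - {j}) = 1" | "card (T - {j}) = 2"
      using \<open>card (T - {j}) \<le> 2\<close> by linarith
    then show ?thesis
    proof cases
      case 1
      then have "T - {j} = {}"
        using T(1) by simp
      then show ?thesis
        using that[OF nz nz] by blast
    next
      case 2
      then obtain i where "T - {j} = {i}"
        by (auto simp: card_1_singleton_iff)
      then show ?thesis
        using ex[of i] that by (metis singletonD singletonI)
    next
      case 3
      then obtain i k where "T - {j} = {i, k}"
        by (auto simp: card_2_iff)
      then show ?thesis
        using ex[of i] ex[of k] that by (metis insertE insertI1 insert_commute singletonD)
    qed
  qed
  then show ?thesis
    using rank_one_relation_coeff_zero[where v = v and \<alpha> = \<alpha>, OF sq T(1) j] by blast
qed

lemma three_faces_through_point_imp_corner: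
  assumes F: "\<forall>i. hermitian (F $ i)"
    and faces: "G \<in> large_faces F" "H \<in> large_faces F" "K \<in> large_faces F"
    and ne: "G \<noteq> H" "G \<noteq> K" "H \<noteq> K" and p: "p \<in> G" "p \<in> H" "p \<in> K"
  shows "corner_point (joint_numerical_range F) p"
proof -
  obtain a b v where ff: "\<And>G. G \<in> large_faces F \<Longrightarrow> face_form F G (a G) (b G) (v G)"
    by (rule large_face_forms[OF F]) blast
  show ?thesis
  proof (rule corner_pointI)
    show "p \<in> joint_numerical_range F"
      using face_form_in_range[OF ff] faces p by blast
    show "a G \<in> normal_cone (joint_numerical_range F) p" "a H \<in> normal_cone (joint_numerical_range F) p"
      "a K \<in> normal_cone (joint_numerical_range F) p"
      using face_form_normal[OF ff] faces p by blast+
    fix \<alpha> \<beta> \<gamma> :: real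
    assume rel: "\<alpha> *\<^sub>R a G + \<beta> *\<^sub>R a H + \<gamma> *\<^sub>R a K = 0"
    define f where "f = (\<lambda>X. if X = G then \<alpha> else if X = H then \<beta> else \<gamma>)"
    have s: "(\<Sum>X\<in>{G, H, K}. f X *\<^sub>R a X) = 0"
      using rel ne by (simp add: f_def add.assoc)
    have "f X = 0" if "X \<in> {G, H, K}" for X
      using faces p
      by (intro face_normals_through_point_coeff_zero[where G = "\<lambda>X. X" and T = "{G, H, K}", OF ff _ _ _ _ s that])
        (auto simp: card_insert_if)
    then show "\<alpha> = 0 \<and> \<beta> = 0 \<and> \<gamma> = 0"
      using ne unfolding f_def by (metis insertI1 insertI2)
  qed
qed

text \<open>Hypothesis \<open>eig\<close> says that x0, the unit vector over p, is a common eigenvector of the matrices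
  with eigenvalues the coordinates of p. The normals a and a' are independent; the third normal is
  a perturbation of a + a' in a direction e orthogonal to both. For it to be a normal, the form of e
  at p, called R below, must be bounded by a multiple of
  \<open>Q x = (cmod (cprod v x))\<^sup>2 + (cmod (cprod v' x))\<^sup>2\<close>. This holds because R does not change when
  multiples of x0 are added to its argument, so that R is a form in the two numbers
  \<open>cprod v x\<close> and \<open>cprod v' x\<close>.\<close>

lemma common_eigenvector_corner:
  assumes F: "\<forall>i. hermitian (F $ i)"
    and G: "face_form F G a b v" "p \<in> G" and H: "face_form F H a' b' v'" "p \<in> H" and "G \<noteq> H"
    and eig: "\<And>e y. cprod x0 (pencil F e (e \<bullet> p) *v y) = 0"
    and x0: "cprod x0 x0 = 1" "cprod v x0 = 0" "cprod v' x0 = 0"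
  shows "corner_point (joint_numerical_range F) p"
proof -
  have "dim {a, a'} \<le> card {a, a'}"
    by (rule dim_le_card) (auto intro: span_base)
  also have "\<dots> \<le> 2"
    by (simp add: card_insert_if)
  finally have "dim {a, a'} < DIM(real^3)"
    by simp
  then obtain e where e: "e \<noteq> 0" "\<And>y. y \<in> span {a, a'} \<Longrightarrow> orthogonal e y"
    using orthogonal_to_subspace_exists by blast
  have ea: "a \<bullet> e = 0" "a' \<bullet> e = 0"
    using e(2)[of a] e(2)[of a'] by (auto simp: orthogonal_def span_base inner_commute)
  define N where "N = pencil F e (e \<bullet> p)"
  have N: "hermitian N"
    unfolding N_def by (rule hermitian_pencil[OF F])
  define R where "R x = Re (cprod x (N *v x))" for x
  have Nx0: "N *v x0 = 0"
    using hermitian_mult_zero[OF N] eig unfolding N_def by blast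
  have c: "ccross v v' \<noteq> 0"
    using distinct_faces_ccross[OF G(1) H(1) \<open>G \<noteq> H\<close>] .
  have c': "ccross v' v \<noteq> 0"
    using distinct_faces_ccross[OF H(1) G(1)] \<open>G \<noteq> H\<close> by simp
  \<comment> \<open>A dual basis of the two functionals on a complement of the line of x0.\<close>
  obtain k where k: "cprod v k = 0" "cprod v' k = 1"
    using separate_functionals[OF c] .
  obtain k' where k': "cprod v' k' = 0" "cprod v k' = 1"
    using separate_functionals[OF c'] .
  define n where "n = cprod k (N *v k')"
  define C where "C = \<bar>R k\<bar> + \<bar>R k'\<bar> + cmod n"
  have bound: "\<bar>R x\<bar> \<le> C * ((cmod (cprod v x))\<^sup>2 + (cmod (cprod v' x))\<^sup>2)" for x
  proof -
    define s t where "s = cprod v' x" and "t = cprod v x"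
    define y where "y = s *s k + t *s k'"
    have "cprod v (x - y) = 0" "cprod v' (x - y) = 0"
      using cprod_add_right[of v "x - y" y] cprod_add_right[of v' "x - y" y]
      by (simp_all add: y_def s_def t_def cprod_linear k k')
    moreover obtain m where m: "x0 = m *s ccross v v'"
      using ccross_spans_annihilator[OF c x0(2,3)] .
    moreover have "m \<noteq> 0"
      using m x0(1) by (auto simp: cprod_linear)
    ultimately obtain l where "x - y = l *s ccross v v'"
      using ccross_spans_annihilator[OF c] by blast
    then have "x - y = (l / m) *s x0"
      using m \<open>m \<noteq> 0\<close> by simp
    then have x: "x = y + (l / m) *s x0"
      by (simp add: algebra_simps)
    have "R x = R y"
      unfolding x R_def hermitian_form_add[OF N] by (simp add: matrix_vector_scale Nx0 cprod_linear)
    also have "\<dots> = (cmod s)\<^sup>2 * R k + 2 * Re (cnj s * t * n) + (cmod t)\<^sup>2 * R k'"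
    proof -
      have "R (s *s k) = (cmod s)\<^sup>2 * R k" for s k
      proof -
        have "cprod (s *s k) (N *v (s *s k)) = of_real ((cmod s)\<^sup>2) * cprod k (N *v k)"
          by (simp add: matrix_vector_scale cprod_linear complex_norm_square mult_ac del: of_real_power)
        then show ?thesis
          by (simp add: R_def del: of_real_power)
      qed
      then show ?thesis
        unfolding y_def R_def hermitian_form_add[OF N]
        by (simp add: matrix_vector_scale cprod_linear n_def mult_ac)
    qed
    finally have Rx: "R x = (cmod s)\<^sup>2 * R k + 2 * Re (cnj s * t * n) + (cmod t)\<^sup>2 * R k'" .
    have 1: "\<bar>(cmod s)\<^sup>2 * R k\<bar> \<le> ((cmod s)\<^sup>2 + (cmod t)\<^sup>2) * \<bar>R k\<bar>"
      unfolding abs_mult by (intro mult_right_mono) auto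
    have 2: "\<bar>(cmod t)\<^sup>2 * R k'\<bar> \<le> ((cmod s)\<^sup>2 + (cmod t)\<^sup>2) * \<bar>R k'\<bar>"
      unfolding abs_mult by (intro mult_right_mono) auto
    have "\<bar>Re (cnj s * t * n)\<bar> \<le> cmod s * cmod t * cmod n"
      using abs_Re_le_cmod[of "cnj s * t * n"] by (simp add: norm_mult)
    moreover have "2 * (cmod s * cmod t) * cmod n \<le> ((cmod s)\<^sup>2 + (cmod t)\<^sup>2) * cmod n"
      using sum_squares_bound[of "cmod s" "cmod t"] by (intro mult_right_mono) auto
    ultimately have "\<bar>2 * Re (cnj s * t * n)\<bar> \<le> ((cmod s)\<^sup>2 + (cmod t)\<^sup>2) * cmod n"
      by simp
    with 1 2 have "\<bar>R x\<bar> \<le> ((cmod s)\<^sup>2 + (cmod t)\<^sup>2) * \<bar>R k\<bar> + ((cmod s)\<^sup>2 + (cmod t)\<^sup>2) * \<bar>R k'\<bar>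
        + ((cmod s)\<^sup>2 + (cmod t)\<^sup>2) * cmod n"
      unfolding Rx by linarith
    then show ?thesis
      by (simp add: C_def s_def t_def algebra_simps)
  qed
  define \<epsilon> where "\<epsilon> = 1 / (C + 1)"
  have C: "0 \<le> C"
    by (simp add: C_def)
  then have \<epsilon>: "0 < \<epsilon>" "\<epsilon> * C \<le> 1"
    by (auto simp: \<epsilon>_def field_simps)
  have third: "a + a' + \<epsilon> *\<^sub>R e \<in> normal_cone (joint_numerical_range F) p"
  proof -
    have "(a + a' + \<epsilon> *\<^sub>R e) \<bullet> (expectation F x - p) \<le> 0" if x: "cprod x x = 1" for x
    proof -
      define Q where "Q = (cmod (cprod v x))\<^sup>2 + (cmod (cprod v' x))\<^sup>2"
      have "e \<bullet> (expectation F x - p) = - R x"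
        using x by (simp add: R_def N_def pencil_form inner_diff_right)
      then have "(a + a' + \<epsilon> *\<^sub>R e) \<bullet> (expectation F x - p) = - Q - \<epsilon> * R x"
        using face_form_gap[OF G x] face_form_gap[OF H x] by (simp add: inner_add_left Q_def)
      also have "- \<epsilon> * R x \<le> \<epsilon> * (C * Q)"
        using bound[of x] \<epsilon>(1) unfolding Q_def[symmetric]
        by (metis abs_le_D2 less_imp_le minus_mult_commute mult_left_mono)
      then have "- Q - \<epsilon> * R x \<le> - Q + \<epsilon> * C * Q"
        by simp
      also have "\<dots> \<le> 0"
        using mult_right_mono[OF \<epsilon>(2), of Q] by (simp add: Q_def)
      finally show ?thesis .
    qed
    then show ?thesis
      by (auto simp: normal_cone_def joint_numerical_range_expectation)
  qed
  show ?thesis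
  proof (rule corner_pointI[OF _ _ _ third])
    show "p \<in> joint_numerical_range F"
      using face_form_in_range[OF G] .
    show "a \<in> normal_cone (joint_numerical_range F) p"
      using face_form_normal[OF G] .
    show "a' \<in> normal_cone (joint_numerical_range F) p"
      using face_form_normal[OF H] .
    fix \<alpha> \<beta> \<gamma>
    assume rel: "\<alpha> *\<^sub>R a + \<beta> *\<^sub>R a' + \<gamma> *\<^sub>R (a + a' + \<epsilon> *\<^sub>R e) = 0"
    have "(\<alpha> *\<^sub>R a + \<beta> *\<^sub>R a' + \<gamma> *\<^sub>R (a + a' + \<epsilon> *\<^sub>R e)) \<bullet> e = 0"
      unfolding rel by simp
    then have \<gamma>: "\<gamma> = 0"
      using e(1) \<epsilon>(1) by (simp add: inner_add_left ea)
    then have rel2: "(\<Sum>i\<in>UNIV. (if i then \<alpha> else \<beta>) *\<^sub>R (if i then a else a')) = 0"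
      using rel by (simp add: UNIV_bool add.commute)
    have "(if i then \<alpha> else \<beta>) = 0" for i
      by (rule face_normals_through_point_coeff_zero[where T = UNIV and F = F and p = p
            and G = "\<lambda>i. if i then G else H" and b = "\<lambda>i. if i then b else b'"
            and v = "\<lambda>i. if i then v else v'", OF _ _ _ _ _ rel2])
        (use G H \<open>G \<noteq> H\<close> in \<open>auto simp: inj_on_def card_UNIV_bool\<close>)
    from this[of True] this[of False] \<gamma> show "\<alpha> = 0 \<and> \<beta> = 0 \<and> \<gamma> = 0"
      by simp
  qed
qed

section \<open>Segments\<close>

text \<open>For a nonzero x in the kernel plane of v, \<open>expectation F x\<close> is a point of the segment times
  the squared norm of x. So the form of e at p has a constant sign on this plane, positive or negative
  according to the sign of \<open>e \<bullet> (q - p)\<close>, and it vanishes at x0.\<close>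

lemma segment_endpoint_orthogonal:
  assumes F: "\<forall>i. hermitian (F $ i)"
    and ff: "face_form F (closed_segment p q) a b v"
    and x0: "cprod x0 x0 = 1" "cprod v x0 = 0" "expectation F x0 = p" and y: "cprod v y = 0"
  shows "cprod x0 (pencil F e (e \<bullet> p) *v y) = 0"
proof -
  have *: "cprod x0 (pencil F e (e \<bullet> p) *v y) = 0" if le: "e \<bullet> (q - p) \<le> 0" for e
  proof (rule nonneg_form_zero_imp_orthogonal[OF hermitian_pencil[OF F]])
    show "Re (cprod x0 (pencil F e (e \<bullet> p) *v x0)) = 0"
      by (simp add: pencil_form x0)
    fix c
    define x where "x = x0 + c *s y"
    have vx: "cprod v x = 0"
      by (simp add: x_def cprod_linear x0 y)
    have "0 \<le> Re (cprod x (pencil F e (e \<bullet> p) *v x))"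
    proof (cases "x = 0")
      case False
      obtain g where g: "g \<in> closed_segment p q" "expectation F x = Re (cprod x x) *\<^sub>R g"
        using face_form_scaled_point[OF ff False vx] .
      then obtain u where u: "0 \<le> u" "g = p + u *\<^sub>R (q - p)"
        unfolding closed_segment_def by (auto simp: algebra_simps)
      have "Re (cprod x (pencil F e (e \<bullet> p) *v x)) = Re (cprod x x) * (u * - (e \<bullet> (q - p)))"
        by (simp add: pencil_form g(2) u(2) inner_add_right algebra_simps)
      then show ?thesis
        using le u(1) cprod_self_pos[OF False] by (simp add: mult_nonneg_nonpos)
    qed (simp add: cprod_zero_left)
    then show "0 \<le> Re (cprod (x0 + c *s y) (pencil F e (e \<bullet> p) *v (x0 + c *s y)))"
      by (simp add: x_def)
  qed
  show ?thesis
  proof (cases "e \<bullet> (q - p) \<le> 0")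
    case False
    then have "cprod x0 (pencil F (- e) ((- e) \<bullet> p) *v y) = 0"
      by (intro *) simp
    then show ?thesis
      using cprod_scale_right[of x0 "-1" "pencil F e (e \<bullet> p) *v y"]
      by (simp add: pencil_uminus)
  qed (rule *)
qed

text \<open>A face that contains a relative interior point of the segment contains its two endpoints,
  but two large faces share only one point.\<close>

lemma face_meets_segment_in_endpoint:
  assumes F: "\<forall>i. hermitian (F $ i)"
    and S: "closed_segment p q \<in> large_faces F" and H: "H \<in> large_faces F" "closed_segment p q \<noteq> H"
    and r: "r \<in> closed_segment p q" "r \<in> H"
  shows "r = p \<or> r = q"
proof (rule ccontr)
  assume "\<not> ?thesis"
  then have "r \<in> open_segment p q"
    using r(1) by (auto simp: open_segment_def)
  moreover have "H face_of joint_numerical_range F"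
    using H(1) unfolding large_faces_def exposed_face_of_def by blast
  moreover obtain a b v where s: "face_form F (closed_segment p q) a b v"
    using large_face_form[OF F S] .
  moreover have "p \<in> joint_numerical_range F" "q \<in> joint_numerical_range F"
    using face_form_in_range[OF s] by auto
  ultimately have "p \<in> H" "q \<in> H"
    using r(2) unfolding face_of_def by blast+
  moreover obtain a' b' v' where "face_form F H a' b' v'"
    using large_face_form[OF F H(1)] .
  then have "\<exists>!p'. p' \<in> closed_segment p q \<inter> H"
    using faces_meet_in_one_point[OF s] H(2) by blast
  ultimately have "p = q"
    by (metis IntI ends_in_segment)
  then show False
    using \<open>\<not> (r = p \<or> r = q)\<close> r(1) by simp
qed

text \<open>The common point p is an endpoint of both segments. Every vector is a sum of vectors from the
  two kernel planes, and on both the vector over p satisfies the orthogonality of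
  \<open>segment_endpoint_orthogonal\<close>; so it is a common eigenvector.\<close>

lemma two_segments_imp_corner:
  assumes F: "\<forall>i. hermitian (F $ i)"
    and G: "G \<in> large_faces F" "nondegenerate_segment G"
    and H: "H \<in> large_faces F" "nondegenerate_segment H" and ne: "G \<noteq> H"
  obtains p where "corner_point (joint_numerical_range F) p"
proof -
  obtain a b v where g: "face_form F G a b v"
    using large_face_form[OF F G(1)] .
  obtain a' b' v' where h: "face_form F H a' b' v'"
    using large_face_form[OF F H(1)] .
  obtain p where p: "p \<in> G" "p \<in> H"
    using faces_meet_in_one_point[OF g h ne] by blast
  have endpoint: "\<exists>q. S = closed_segment p q"
    if S: "S \<in> large_faces F" "nondegenerate_segment S" "S' \<in> large_faces F" "S \<noteq> S'" "p \<in> S" "p \<in> S'"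
    for S S' :: "(real^3) set"
  proof -
    obtain s t where st: "S = closed_segment s t"
      using S(2) unfolding nondegenerate_segment_def by blast
    then have "p = s \<or> p = t"
      using face_meets_segment_in_endpoint[OF F] S by blast
    then show ?thesis
      using st closed_segment_commute by blast
  qed
  obtain q where q: "G = closed_segment p q"
    using endpoint G H ne p by blast
  obtain q' where q': "H = closed_segment p q'"
    using endpoint G H ne p by blast
  obtain x0 where x0: "cprod x0 x0 = 1" "cprod v x0 = 0" "expectation F x0 = p"
    using p(1) unfolding face_formD(3)[OF g] by blast
  have x0': "cprod v' x0 = 0"
    using point_of_face_kernel[OF h x0(1)] x0(3) p(2) by simp
  obtain k where k: "cprod v k = 0" "cprod v' k = 1"
    using separate_functionals[OF distinct_faces_ccross[OF g h ne]] .
  have "cprod x0 (pencil F e (e \<bullet> p) *v y) = 0" for e y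
  proof -
    define y1 where "y1 = cprod v' y *s k"
    have "cprod v' (y - y1) = 0"
      using cprod_add_right[of v' "y - y1" y1] by (simp add: y1_def cprod_linear k)
    then have "cprod x0 (pencil F e (e \<bullet> p) *v (y - y1)) = 0"
      using segment_endpoint_orthogonal[OF F h[unfolded q'] x0(1) x0' x0(3)] by blast
    moreover have "cprod x0 (pencil F e (e \<bullet> p) *v y1) = 0"
      using k by (intro segment_endpoint_orthogonal[OF F g[unfolded q] x0])
        (simp add: y1_def cprod_linear)
    ultimately have "cprod x0 (pencil F e (e \<bullet> p) *v (y - y1 + y1)) = 0"
      by (simp only: matrix_vector_right_distrib cprod_linear add_0)
    then show ?thesis
      by simp
  qed
  then show ?thesis
    using that common_eigenvector_corner[OF F g p(1) h p(2) ne _ x0(1,2) x0'] by blast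
qed

section \<open>Counting large faces\<close>

text \<open>The pairs (a, b) of five large faces satisfy a linear relation, since they lie in a real space
  of dimension four. For a face K with nonzero coefficient the other four faces are split into two
  pairs; a vector that annihilates both members of a pair is not annihilated by the functional of
  K, as otherwise three large faces would share a point.\<close>

lemma no_five_large_faces:
  assumes F: "\<forall>i. hermitian (F $ i)"
    and no_corner: "\<not> (\<exists>p. corner_point (joint_numerical_range F) p)"
    and T: "T \<subseteq> large_faces F"
  shows "card T \<noteq> 5"
proof
  assume card: "card T = 5"
  then have fin: "finite T"
    using card.infinite by fastforce
  obtain a b v where form: "\<And>G. G \<in> large_faces F \<Longrightarrow> face_form F G (a G) (b G) (v G)"
    by (rule large_face_forms[OF F]) blast
  have ff: "face_form F G (a G) (b G) (v G)" if "G \<in> T" for G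
    using form that T by blast
  have common: "\<exists>x. x \<noteq> 0 \<and> cprod (v G) x = 0 \<and> cprod (v H) x = 0 \<and> cprod (v K) x \<noteq> 0"
    if "G \<in> T" "H \<in> T" "K \<in> T" "G \<noteq> H" "G \<noteq> K" "H \<noteq> K" for G H K
  proof -
    define x where "x = ccross (v G) (v H)"
    have x: "x \<noteq> 0" "cprod (v G) x = 0" "cprod (v H) x = 0"
      using distinct_faces_ccross[OF ff[OF that(1)] ff[OF that(2)] that(4)]
      by (simp_all add: x_def cprod_ccross)
    obtain p where p: "\<And>G a b v. face_form F G a b v \<Longrightarrow> cprod v x = 0 \<Longrightarrow> p \<in> G"
      using common_kernel_imp_common_point[OF x(1), of F] by blast
    have "cprod (v K) x \<noteq> 0"
    proof
      assume "cprod (v K) x = 0"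
      then have "p \<in> G" "p \<in> H" "p \<in> K"
        using p[OF ff[OF that(1)] x(2)] p[OF ff[OF that(2)] x(3)] p[OF ff[OF that(3)]] by simp_all
      moreover have "G \<in> large_faces F" "H \<in> large_faces F" "K \<in> large_faces F"
        using T that(1-3) by auto
      ultimately show False
        using three_faces_through_point_imp_corner[OF F _ _ _ that(4-6)] no_corner by blast
    qed
    then show ?thesis
      using x by blast
  qed
  define f where "f G = (a G, b G)" for G
  have "\<exists>\<alpha>. (\<exists>G\<in>T. \<alpha> G \<noteq> 0) \<and> (\<Sum>G\<in>T. \<alpha> G *\<^sub>R f G) = 0"
  proof (cases "inj_on f T")
    case True
    then have "card (f ` T) = 5"
      using card by (simp add: card_image)
    then have "dependent (f ` T)"
      using fin by (intro dependent_biggerset) auto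
    then obtain u where "\<exists>z\<in>f ` T. u z \<noteq> 0" "(\<Sum>z\<in>f ` T. u z *\<^sub>R z) = 0"
      using dependent_finite[of "f ` T"] fin by auto
    then show ?thesis
      using True by (intro exI[of _ "u \<circ> f"]) (auto simp: sum.reindex)
  next
    case False
    then obtain G H where GH: "G \<in> T" "H \<in> T" "G \<noteq> H" "f G = f H"
      unfolding inj_on_def by blast
    define \<alpha> :: "(real^3) set \<Rightarrow> real" where "\<alpha> X = (if X = G then 1 else if X = H then -1 else 0)" for X
    have "(\<Sum>X\<in>T. \<alpha> X *\<^sub>R f X) = (\<Sum>X\<in>{G, H}. \<alpha> X *\<^sub>R f X)"
      using fin GH by (intro sum.mono_neutral_right) (auto simp: \<alpha>_def)
    also have "\<dots> = 0"
      using GH by (simp add: \<alpha>_def)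
    finally show ?thesis
      using GH(1) by (intro exI[of _ \<alpha>]) (auto simp: \<alpha>_def)
  qed
  then obtain \<alpha> K where K: "K \<in> T" "\<alpha> K \<noteq> 0" and rel: "(\<Sum>G\<in>T. \<alpha> G *\<^sub>R f G) = 0"
    by blast
  have sq: "(\<Sum>G\<in>T. \<alpha> G * (cmod (cprod (v G) x))\<^sup>2) = 0" for x
  proof (rule face_normals_relation[OF fin, where G = "\<lambda>G. G", OF ff])
    show "(\<Sum>G\<in>T. \<alpha> G *\<^sub>R a G) = 0" "(\<Sum>G\<in>T. \<alpha> G * b G) = 0"
      using arg_cong[OF rel, of fst] arg_cong[OF rel, of snd]
      by (simp_all add: f_def fst_sum snd_sum)
  qed
  have "card (T - {K}) = 4"
    using fin card K(1) by simp
  moreover obtain xs where xs: "set xs = T - {K}" "distinct xs"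
    using finite_distinct_list fin by (metis finite_Diff)
  ultimately have "length xs = Suc (Suc (Suc (Suc 0)))"
    using distinct_card[OF xs(2)] by simp
  then obtain G1 G2 G3 G4 where "xs = [G1, G2, G3, G4]"
    by (auto simp: length_Suc_conv)
  with xs have G: "T - {K} = {G1, G2, G3, G4}" "G1 \<noteq> G2" "G3 \<noteq> G4"
    by auto
  then have mem: "G1 \<in> T" "G2 \<in> T" "G3 \<in> T" "G4 \<in> T" "G1 \<noteq> K" "G2 \<noteq> K" "G3 \<noteq> K" "G4 \<noteq> K"
    by blast+
  obtain x where x: "cprod (v G1) x = 0" "cprod (v G2) x = 0" "cprod (v K) x \<noteq> 0"
    using common[of G1 G2 K] G mem K(1) by blast
  obtain y where y: "cprod (v G3) y = 0" "cprod (v G4) y = 0" "cprod (v K) y \<noteq> 0"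
    using common[of G3 G4 K] G mem K(1) by blast
  have kill: "cprod (v i) x = 0 \<or> cprod (v i) y = 0" if "i \<in> T" "i \<noteq> K" for i
  proof -
    have "i \<in> {G1, G2, G3, G4}"
      using that G(1) by blast
    then show ?thesis
      using x y by auto
  qed
  have "\<alpha> K = 0"
    by (rule rank_one_relation_coeff_zero[where v = v and \<alpha> = \<alpha>, OF sq fin K(1) kill x(3) y(3)])
  with K(2) show False ..
qed

theorem theorem1p1:
  fixes F :: "(complex^3^3)^3"
  assumes "\<forall>i. hermitian (F $ i)"
    and "\<not> (\<exists>p. corner_point (joint_numerical_range F) p)"
  shows "finite (large_faces F) \<and>
    (card {G \<in> large_faces F. filled_ellipse G},
     card {G \<in> large_faces F. nondegenerate_segment G})
      \<in> {(0,0), (1,0), (2,0), (3,0), (4,0), (0,1), (1,1), (2,1)} \<and>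
    (\<forall>G\<in>large_faces F. \<forall>H\<in>large_faces F. G \<noteq> H \<longrightarrow> (\<exists>!p. p \<in> G \<inter> H)) \<and>
    \<not> (\<exists>p. \<exists>G\<in>large_faces F. \<exists>H\<in>large_faces F. \<exists>K\<in>large_faces F.
          G \<noteq> H \<and> G \<noteq> K \<and> H \<noteq> K \<and> p \<in> G \<and> p \<in> H \<and> p \<in> K)"
proof -
  let ?L = "large_faces F"
  define E where "E = {G \<in> ?L. filled_ellipse G}"
  define S where "S = {G \<in> ?L. nondegenerate_segment G}"
  note no_five = no_five_large_faces[OF assms]
  have fin: "finite ?L"
    using infinite_arbitrarily_large[of ?L 5] no_five by blast
  have four: "card ?L \<le> 4"
  proof (rule ccontr)
    assume "\<not> ?thesis"
    then have "5 \<le> card ?L"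
      by simp
    then show False
      using obtain_subset_with_card_n[of 5 ?L] no_five by metis
  qed
  have pair: "\<exists>!p. p \<in> G \<inter> H" if "G \<in> ?L" "H \<in> ?L" "G \<noteq> H" for G H
    using large_face_forms[OF assms(1)] faces_meet_in_one_point that by metis
  have triple: "\<not> (\<exists>p. \<exists>G\<in>?L. \<exists>H\<in>?L. \<exists>K\<in>?L.
          G \<noteq> H \<and> G \<noteq> K \<and> H \<noteq> K \<and> p \<in> G \<and> p \<in> H \<and> p \<in> K)"
    using three_faces_through_point_imp_corner[OF assms(1)] assms(2) by blast
  have "(card E, card S) \<in> {(0,0), (1,0), (2,0), (3,0), (4,0), (0,1), (1,1), (2,1)}"
  proof (cases "S = {}")
    case True
    have "card E \<le> card ?L"
      using fin by (intro card_mono) (auto simp: E_def)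
    then have "card E \<in> {0, 1, 2, 3, 4}"
      using four by auto
    then show ?thesis
      using True by auto
  next
    case False
    then obtain G where G: "G \<in> ?L" "nondegenerate_segment G"
      unfolding S_def by blast
    have "S = {G}"
      using two_segments_imp_corner[OF assms(1) G] assms(2) G unfolding S_def by blast
    then have cS: "card S = 1"
      by simp
    obtain p q where pq: "G = closed_segment p q"
      using G(2) unfolding nondegenerate_segment_def by blast
    have EG: "H \<in> ?L" "G \<noteq> H" if "H \<in> E" for H
      using that G(2) filled_ellipse_not_segment unfolding E_def by auto
    have "\<exists>r. r \<in> G \<and> r \<in> H" if "H \<in> E" for H
      using pair[OF G(1) EG[OF that]] by blast
    then obtain r where r: "\<And>H. H \<in> E \<Longrightarrow> r H \<in> G \<and> r H \<in> H"
      by metis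
    have "r ` E \<subseteq> {p, q}"
      using face_meets_segment_in_endpoint[OF assms(1)] G(1) EG r unfolding pq by blast
    moreover have "inj_on r E"
      using triple EG r G(1) unfolding inj_on_def by metis
    ultimately have "card E \<le> card {p, q}"
      by (intro card_inj_on_le) auto
    also have "\<dots> \<le> 2"
      by (simp add: card_insert_if)
    finally have "card E \<in> {0, 1, 2}"
      by auto
    then show ?thesis
      using cS by auto
  qed
  then show ?thesis
    unfolding E_def S_def using fin pair triple by (intro conjI ballI impI)
qed

end
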